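(* Let $B_2=E_{(1,1)}=\{0,p,q,1\}$ with $p=(1,0)$, $q=(0,1)$, $1=p\oplus q$. A binary operation $\circ$ on $B_2$ satisfies (S1), (S2) and (S3) if and only if there exist nonzero additive maps $A,B:B_2\to B_2$ with $A(q)=0\iff B(p)=0$ such that for all $x\in B_2$: $0\circ x=0$, $p\circ x=A(x)$, $q\circ x=B(x)$, $1\circ x=x$. Equivalently, writing $u=A(p), v=A(q), s=B(p), t=B(q)$: $u\perp v$, $s\perp t$, $(u,v)\ne(0,0)$, $(s,t)\neq(0,0)$, and $v=0\iff s=0$. There are exactly $34$ such operations.
   Context: For $\mathbf u\in\mathbb{N}_{>0}^r$, $E_{\mathbf u}=\{x\in\mathbb{Z}_{\ge 0}^r: 0\le x\le \mathbf u\}$ with partial addition $x\oplus y=x+y$ defined (written $x\perp y$) iff $x+y\le \mathbf u$, top element $1=\mathbf u$. A map $L$ is additive if $x\perp y$ implies $L(x\oplus y)=L(x)\oplus L(y)$. Axioms for a total binary operation $\circ$: (S1) $b\perp c\Rightarrow a\circ(b\oplus c)=(a\circ b)\oplus(a\circ c)$; (S2) $1\circ a=a$; (S3) $a\circ b=0\Rightarrow a\circ b=b\circ a$. *)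

theory Defs
  imports "HOL-Analysis.Analysis" "HOL-Library.FuncSet"
begin

definition EA :: "nat ^ 'r \<Rightarrow> (nat ^ 'r) set"
  where "EA w = {x. 0 \<le> x \<and> x \<le> w}"

text \<open>
  The partial sum of \<open>x\<close> and \<open>y\<close> is defined iff \<open>orth w x y\<close>; its value is then \<open>x + y\<close>.
  Every equation below that involves a partial sum therefore carries an \<open>orth\<close> condition
  on its summands.
\<close>

definition orth :: "nat ^ 'r \<Rightarrow> nat ^ 'r \<Rightarrow> nat ^ 'r \<Rightarrow> bool"
  where "orth w x y \<longleftrightarrow> x + y \<le> w"

definition additive_map :: "nat ^ 'r \<Rightarrow> (nat ^ 'r \<Rightarrow> nat ^ 'r) \<Rightarrow> bool"
  where "additive_map w L \<longleftrightarrow> L \<in> EA w \<rightarrow> EA w \<and>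
    (\<forall>x\<in>EA w. \<forall>y\<in>EA w. orth w x y \<longrightarrow> orth w (L x) (L y) \<and> L (x + y) = L x + L y)"

definition nonzero_map :: "nat ^ 'r \<Rightarrow> (nat ^ 'r \<Rightarrow> nat ^ 'r) \<Rightarrow> bool"
  where "nonzero_map w L \<longleftrightarrow> (\<exists>x\<in>EA w. L x \<noteq> 0)"

definition binop_on :: "nat ^ 'r \<Rightarrow> (nat ^ 'r \<Rightarrow> nat ^ 'r \<Rightarrow> nat ^ 'r) \<Rightarrow> bool"
  where "binop_on w f \<longleftrightarrow> (\<forall>a\<in>EA w. \<forall>b\<in>EA w. f a b \<in> EA w)"

definition S1 :: "nat ^ 'r \<Rightarrow> (nat ^ 'r \<Rightarrow> nat ^ 'r \<Rightarrow> nat ^ 'r) \<Rightarrow> bool"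
  where "S1 w f \<longleftrightarrow> (\<forall>a\<in>EA w. \<forall>b\<in>EA w. \<forall>c\<in>EA w.
    orth w b c \<longrightarrow> orth w (f a b) (f a c) \<and> f a (b + c) = f a b + f a c)"

definition S2 :: "nat ^ 'r \<Rightarrow> (nat ^ 'r \<Rightarrow> nat ^ 'r \<Rightarrow> nat ^ 'r) \<Rightarrow> bool"
  where "S2 w f \<longleftrightarrow> (\<forall>a\<in>EA w. f w a = a)"

definition S3 :: "nat ^ 'r \<Rightarrow> (nat ^ 'r \<Rightarrow> nat ^ 'r \<Rightarrow> nat ^ 'r) \<Rightarrow> bool"
  where "S3 w f \<longleftrightarrow> (\<forall>a\<in>EA w. \<forall>b\<in>EA w. f a b = 0 \<longrightarrow> f a b = f b a)"

definition p :: "nat ^ 2" where "p = vector [1, 0]"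
definition q :: "nat ^ 2" where "q = vector [0, 1]"
definition e :: "nat ^ 2" where "e = vector [1, 1]"

abbreviation B2 :: "(nat ^ 2) set" where "B2 \<equiv> EA e"

lemma B2_eq: "B2 = {0, p, q, e}"
proof -
  have "x \<in> B2 \<longleftrightarrow> x \<in> {0, p, q, e}" for x
    by (auto simp: EA_def p_def q_def e_def less_eq_vec_def vec_eq_iff forall_2)
  then show ?thesis by blast
qed

lemma e_eq: "orth e p q" "e = p + q"
  by (auto simp: orth_def p_def q_def e_def less_eq_vec_def vec_eq_iff forall_2)

definition admissible_maps :: "(nat ^ 2 \<Rightarrow> nat ^ 2) \<Rightarrow> (nat ^ 2 \<Rightarrow> nat ^ 2) \<Rightarrow> bool"
  where "admissible_maps A B \<longleftrightarrow>
    additive_map e A \<and> nonzero_map e A \<and> additive_map e B \<and> nonzero_map e B \<and>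
    (A q = 0 \<longleftrightarrow> B p = 0)"

definition admissible_values :: "nat ^ 2 \<Rightarrow> nat ^ 2 \<Rightarrow> nat ^ 2 \<Rightarrow> nat ^ 2 \<Rightarrow> bool"
  where "admissible_values u v s t \<longleftrightarrow>
    orth e u v \<and> orth e s t \<and> (u, v) \<noteq> (0, 0) \<and> (s, t) \<noteq> (0, 0) \<and> (v = 0 \<longleftrightarrow> s = 0)"

end

theory Submission
  imports Defs
begin

text \<open>
  On \<open>B2\<close> an additive map is an arbitrary pair of orthogonal values at \<open>p\<close> and \<open>q\<close>,
  extended by \<open>0\<close> at \<open>0\<close> and by their sum at \<open>e\<close>. Axiom (S3) applied to \<open>a \<circ> 0 = 0\<close> forces
  \<open>0 \<circ> a = 0\<close>, applied to \<open>a\<close> and \<open>e\<close> it forbids \<open>a \<circ> e = 0\<close> for \<open>a \<noteq> 0\<close> because of (S2), and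
  applied to \<open>p\<close> and \<open>q\<close> it says that \<open>v = p \<circ> q\<close> vanishes iff \<open>s = q \<circ> p\<close> does. Of the eight nonzero orthogonal
  pairs \<open>(u, v)\<close>, three have \<open>v = 0\<close> and five have \<open>v \<noteq> 0\<close>, and likewise for
  \<open>(s, t)\<close> according to \<open>s\<close>, which gives
  \<open>3 * 3 + 5 * 5 = 34\<close> operations.
\<close>

lemma B2_distinct [simp]:
  "p \<noteq> 0" "q \<noteq> 0" "e \<noteq> 0" "p \<noteq> q" "p \<noteq> e" "q \<noteq> e"
  "0 \<noteq> p" "0 \<noteq> q" "0 \<noteq> e" "q \<noteq> p" "e \<noteq> p" "e \<noteq> q"
  by (auto simp: p_def q_def e_def vec_eq_iff forall_2)

lemma B2_mem [simp]: "0 \<in> B2" "p \<in> B2" "q \<in> B2" "e \<in> B2"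
  by (simp_all add: B2_eq)

lemma p_plus_q [simp]: "p + q = e" "q + p = e"
  by (simp_all add: e_eq(2) add.commute)

lemma orth_B2 [simp]:
  "orth e 0 0" "orth e 0 p" "orth e 0 q" "orth e 0 e"
  "orth e p 0" "orth e q 0" "orth e e 0" "orth e p q" "orth e q p"
  "\<not> orth e p p" "\<not> orth e q q" "\<not> orth e e e"
  "\<not> orth e p e" "\<not> orth e q e" "\<not> orth e e p" "\<not> orth e e q"
  by (auto simp: orth_def p_def q_def e_def less_eq_vec_def forall_2)

lemma orth_zero_iff [simp]: "orth w 0 x \<longleftrightarrow> x \<in> EA w" "orth w x 0 \<longleftrightarrow> x \<in> EA w"
  by (auto simp: orth_def EA_def less_eq_vec_def)

lemma orth_commute: "orth w x y \<longleftrightarrow> orth w y x"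
  by (simp add: orth_def add.commute)

lemma orth_plus_mem: "orth w x y \<Longrightarrow> x + y \<in> EA w"
  by (simp add: orth_def EA_def less_eq_vec_def)

lemma vec_nat_add_eq_0_iff [simp]: "x + y = 0 \<longleftrightarrow> x = 0 \<and> y = (0 :: nat ^ 'r)"
  by (auto simp: vec_eq_iff)

text \<open>Apart from sums with \<open>0\<close>, the only defined sum in \<open>B2\<close> is that
  of \<open>p\<close> and \<open>q\<close>, so additivity reduces to this sum once
  \<open>L 0 = 0\<close>.\<close>

lemma additive_map_B2_iff:
  "additive_map e L \<longleftrightarrow>
    L p \<in> B2 \<and> L q \<in> B2 \<and> orth e (L p) (L q) \<and> L 0 = 0 \<and> L e = L p + L q"
  (is "?lhs \<longleftrightarrow> ?rhs")
proof
  assume L: ?lhs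
  have add: "orth e (L x) (L y) \<and> L (x + y) = L x + L y"
    if "x \<in> B2" "y \<in> B2" "orth e x y" for x y
    using L that by (auto simp: additive_map_def)
  have "L p \<in> B2" "L q \<in> B2"
    using L by (auto simp: additive_map_def)
  \<comment> \<open>Additivity gives \<open>L 0 = L 0 + L 0\<close>, and addition of vectors of
    naturals is cancellative.\<close>
  moreover have "L 0 = 0"
    using add [of 0 0] by simp
  ultimately show ?rhs
    using add [of p q] by simp
next
  assume R: ?rhs
  then have "L e \<in> B2"
    using orth_plus_mem by metis
  with R show ?lhs
    unfolding additive_map_def
    by (auto simp: B2_eq Pi_iff orth_commute add.commute)
qed

text \<open>Vectors of naturals cannot cancel, so \<open>L e = L p + L q\<close> vanishes only if
  both summands do.\<close>

lemma nonzero_map_B2_iff: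
  "additive_map e L \<Longrightarrow> nonzero_map e L \<longleftrightarrow> (L p, L q) \<noteq> (0, 0)"
  by (auto simp: additive_map_B2_iff nonzero_map_def B2_eq)

lemma admissible_maps_iff:
  "admissible_maps A B \<longleftrightarrow>
    additive_map e A \<and> additive_map e B \<and> admissible_values (A p) (A q) (B p) (B q)"
  unfolding admissible_maps_def admissible_values_def
  using nonzero_map_B2_iff by (auto simp: additive_map_B2_iff)

text \<open>Additivity depends only on the restriction to \<open>B2\<close>. It can therefore be
  transferred between \<open>f p\<close>, \<open>f q\<close> and maps \<open>A\<close>,
  \<open>B\<close> that are only known to agree with them there.\<close>

lemma additive_map_cong:
  assumes "\<And>x. x \<in> B2 \<Longrightarrow> L x = M x"
  shows "additive_map e L \<longleftrightarrow> additive_map e M"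
  using assms by (simp add: additive_map_B2_iff)

definition map_B2 :: "nat ^ 2 \<Rightarrow> nat ^ 2 \<Rightarrow> nat ^ 2 \<Rightarrow> nat ^ 2"
  where "map_B2 u v x = (if x = p then u else if x = q then v else if x = e then u + v else 0)"

lemma map_B2_simps [simp]:
  "map_B2 u v 0 = 0" "map_B2 u v p = u" "map_B2 u v q = v" "map_B2 u v e = u + v"
  by (simp_all add: map_B2_def)

lemma additive_map_B2:
  "u \<in> B2 \<Longrightarrow> v \<in> B2 \<Longrightarrow> orth e u v \<Longrightarrow> additive_map e (map_B2 u v)"
  by (simp add: additive_map_B2_iff)

lemma S1_iff_additive_map:
  "binop_on w f \<Longrightarrow> S1 w f \<longleftrightarrow> (\<forall>a\<in>EA w. additive_map w (f a))"
  by (auto simp: S1_def additive_map_def binop_on_def)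

text \<open>The rows \<open>f p\<close> and \<open>f q\<close> are themselves the only candidates
  for \<open>A\<close> and \<open>B\<close> up to their values outside \<open>B2\<close>, so this
  form needs no existential quantifier.\<close>

lemma axioms_iff_admissible_maps:
  assumes f: "binop_on e f"
  shows "S1 e f \<and> S2 e f \<and> S3 e f \<longleftrightarrow>
    admissible_maps (f p) (f q) \<and> (\<forall>x\<in>B2. f 0 x = 0 \<and> f e x = x)"
    (is "?lhs \<longleftrightarrow> ?rhs")
proof
  assume L: ?lhs
  then have add: "additive_map e (f a)" if "a \<in> B2" for a
    using that S1_iff_additive_map [OF f] by blast
  have comm: "f b a = 0" if "f a b = 0" "a \<in> B2" "b \<in> B2" for a b
    using L that by (simp add: S3_def)
  have e: "f e x = x" if "x \<in> B2" for x
    using L that by (simp add: S2_def)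
  have "f 0 x = 0" if "x \<in> B2" for x
    using add [OF that] comm [of x 0] that by (simp add: additive_map_B2_iff)
  moreover have "f a e \<noteq> 0" if "a \<in> B2" "a \<noteq> 0" for a
    using comm [of a e] e [of a] that by auto
  then have "f p e \<noteq> 0" "f q e \<noteq> 0"
    by simp_all
  then have "nonzero_map e (f p)" "nonzero_map e (f q)"
    by (auto simp: nonzero_map_def intro!: bexI [of _ e])
  ultimately show ?rhs
    using add [of p] add [of q] comm [of p q] comm [of q p] e
    by (auto simp: admissible_maps_def)
next
  assume R: ?rhs
  then have adm: "additive_map e (f p)" "additive_map e (f q)"
    "admissible_values (f p p) (f p q) (f q p) (f q q)"
    by (auto simp: admissible_maps_iff)
  have 0: "f 0 x = 0" and e: "f e x = x" if "x \<in> B2" for x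
    using R that by auto
  have "additive_map e (f 0)" "additive_map e (f e)"
    by (simp_all add: additive_map_B2_iff 0 e)
  with adm have "\<forall>a\<in>B2. additive_map e (f a)"
    by (simp add: B2_eq)
  then have "S1 e f"
    using S1_iff_additive_map [OF f] by blast
  moreover have "S2 e f"
    using e by (simp add: S2_def)
  \<comment> \<open>Among the sixteen pairs, diagonal ones are trivial and those containing
    \<open>0\<close> give \<open>0\<close> on both sides. A product of \<open>p\<close> or
    \<open>q\<close> with \<open>e\<close> is nonzero, since neither row vanishes. The pair
    \<open>p\<close>, \<open>q\<close> is the equivalence in
    \<open>admissible_values\<close>.\<close>
  moreover have "S3 e f"
    using adm 0 e
    by (auto simp: S3_def B2_eq additive_map_B2_iff admissible_values_def)
  ultimately show ?lhs
    by blast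
qed

lemma axioms_iff_maps:
  assumes f: "binop_on e f"
  shows "S1 e f \<and> S2 e f \<and> S3 e f \<longleftrightarrow>
    (\<exists>A B. admissible_maps A B \<and>
      (\<forall>x\<in>B2. f 0 x = 0 \<and> f p x = A x \<and> f q x = B x \<and> f e x = x))"
proof -
  have "admissible_maps (f p) (f q)"
    if "admissible_maps A B" "\<forall>x\<in>B2. f p x = A x \<and> f q x = B x" for A B
    using that additive_map_cong [of "f p" A] additive_map_cong [of "f q" B]
    by (simp add: admissible_maps_iff)
  then show ?thesis
    unfolding axioms_iff_admissible_maps [OF f] by blast
qed

lemma admissible_maps_iff_values:
  assumes "u \<in> B2" "v \<in> B2" "s \<in> B2" "t \<in> B2"
  shows "(\<exists>A B. admissible_maps A B \<and> A p = u \<and> A q = v \<and> B p = s \<and> B q = t)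
    \<longleftrightarrow> admissible_values u v s t"
proof
  assume adm: "admissible_values u v s t"
  then have "orth e u v" "orth e s t"
    by (simp_all add: admissible_values_def)
  with assms adm have "admissible_maps (map_B2 u v) (map_B2 s t)"
    by (simp add: admissible_maps_iff additive_map_B2)
  then show "\<exists>A B. admissible_maps A B \<and> A p = u \<and> A q = v \<and> B p = s \<and> B q = t"
    by (intro exI [of _ "map_B2 u v"] exI [of _ "map_B2 s t"]) simp
qed (auto simp: admissible_maps_iff)

lemma axioms_iff_values:
  assumes f: "binop_on e f"
  shows "S1 e f \<and> S2 e f \<and> S3 e f \<longleftrightarrow>
    (\<exists>u\<in>B2. \<exists>v\<in>B2. \<exists>s\<in>B2. \<exists>t\<in>B2. admissible_values u v s t \<and>
      (\<forall>x\<in>B2. f 0 x = 0 \<and> f e x = x) \<and>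
      f p 0 = 0 \<and> f p p = u \<and> f p q = v \<and> f p e = u + v \<and>
      f q 0 = 0 \<and> f q p = s \<and> f q q = t \<and> f q e = s + t)"
proof -
  have "f p p \<in> B2" "f p q \<in> B2" "f q p \<in> B2" "f q q \<in> B2"
    using f by (simp_all add: binop_on_def)
  then show ?thesis
    unfolding axioms_iff_admissible_maps [OF f] admissible_maps_iff additive_map_B2_iff
    by (auto simp: admissible_values_def)
qed

text \<open>The second pair is stored as \<open>(t, s)\<close>, so that for both pairs the dividing
  question is whether the second component is \<open>0\<close>. The same two lists of pairs then
  serve for \<open>(u, v)\<close> and \<open>(t, s)\<close>.\<close>

lemma admissible_values_eq:
  "{(u, v, s, t). u \<in> B2 \<and> v \<in> B2 \<and> s \<in> B2 \<and> t \<in> B2 \<and> admissible_values u v s t} =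
    (\<lambda>((u, v), (t, s)). (u, v, s, t)) `
      (({p, q, e} \<times> {0}) \<times> ({p, q, e} \<times> {0}) \<union>
       {(0, p), (0, q), (0, e), (p, q), (q, p)} \<times> {(0, p), (0, q), (0, e), (p, q), (q, p)})"
  (is "?V = ?h ` (?P \<times> ?P \<union> ?Q \<times> ?Q)")
proof -
  define P where "P = ?P"
  define Q where "Q = ?Q"
  have P: "(x, y) \<in> P \<longleftrightarrow> x \<in> B2 \<and> y \<in> B2 \<and> orth e x y \<and> (x, y) \<noteq> (0, 0) \<and> y = 0"
    and Q: "(x, y) \<in> Q \<longleftrightarrow> x \<in> B2 \<and> y \<in> B2 \<and> orth e x y \<and> (x, y) \<noteq> (0, 0) \<and> y \<noteq> 0"
    for x y
    by (auto simp: P_def Q_def B2_eq)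
  have V: "(u, v, s, t) \<in> ?V \<longleftrightarrow> ((u, v), (t, s)) \<in> P \<times> P \<union> Q \<times> Q" for u v s t
    unfolding Un_iff mem_Times_iff fst_conv snd_conv P Q
    by (auto simp: admissible_values_def orth_commute [of e s])
  have h: "(u, v, s, t) \<in> ?h ` X \<longleftrightarrow> ((u, v), (t, s)) \<in> X" for u v s t X
    by force
  have "?V = ?h ` (P \<times> P \<union> Q \<times> Q)"
    by (simp only: set_eq_iff split_paired_All V h simp_thms)
  then show ?thesis
    unfolding P_def Q_def .
qed

lemma card_admissible_values:
  "card {(u, v, s, t). u \<in> B2 \<and> v \<in> B2 \<and> s \<in> B2 \<and> t \<in> B2 \<and> admissible_values u v s t} = 34"
proof -
  \<comment> \<open>Regrouping loses no information, so it remains to count two disjoint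
    products.\<close>
  have "inj_on (\<lambda>((u, v), (t, s)). (u, v, s, t)) X" for X
    :: "(((nat ^ 2) \<times> (nat ^ 2)) \<times> (nat ^ 2) \<times> (nat ^ 2)) set"
    by (auto simp: inj_on_def)
  then show ?thesis
    unfolding admissible_values_eq
    by (subst card_image) (auto simp: card_Un_disjoint card_cartesian_product)
qed

text \<open>Both abstractions are restricted to \<open>B2\<close>, which makes the operation
  extensional in each argument.\<close>

definition binop_B2 :: "nat ^ 2 \<Rightarrow> nat ^ 2 \<Rightarrow> nat ^ 2 \<Rightarrow> nat ^ 2 \<Rightarrow> nat ^ 2 \<Rightarrow> nat ^ 2 \<Rightarrow> nat ^ 2"
  where "binop_B2 u v s t = (\<lambda>a\<in>B2. \<lambda>x\<in>B2.
    if a = p then map_B2 u v x else if a = q then map_B2 s t x else if a = e then x else 0)"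

text \<open>Extensionality makes each operation on \<open>B2\<close> correspond to exactly one
  function. Reading off the four values at \<open>p\<close> and \<open>q\<close> is then a bijection
  onto the admissible quadruples, with inverse \<open>binop_B2\<close>.\<close>

lemma card_axioms:
  "card {f \<in> B2 \<rightarrow>\<^sub>E (B2 \<rightarrow>\<^sub>E B2). S1 e f \<and> S2 e f \<and> S3 e f} = 34"
proof -
  let ?F = "{f \<in> B2 \<rightarrow>\<^sub>E (B2 \<rightarrow>\<^sub>E B2). S1 e f \<and> S2 e f \<and> S3 e f}"
  let ?V = "{(u, v, s, t). u \<in> B2 \<and> v \<in> B2 \<and> s \<in> B2 \<and> t \<in> B2 \<and> admissible_values u v s t}"
  let ?g = "\<lambda>f. (f p p, f p q, f q p, f q q)"
  let ?h = "\<lambda>(u, v, s, t). binop_B2 u v s t"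
  have binop: "binop_on e f" if "f \<in> B2 \<rightarrow>\<^sub>E (B2 \<rightarrow>\<^sub>E B2)" for f
    using that by (auto simp: binop_on_def PiE_iff)
  have g: "?g f \<in> ?V \<and> ?h (?g f) = f" if "f \<in> ?F" for f
  proof -
    from that have f: "f \<in> B2 \<rightarrow>\<^sub>E (B2 \<rightarrow>\<^sub>E B2)"
      by simp
    from that have vals: "?g f \<in> ?V" "\<forall>x\<in>B2. f 0 x = 0 \<and> f e x = x"
      "f p 0 = 0" "f p e = f p p + f p q" "f q 0 = 0" "f q e = f q p + f q q"
      using axioms_iff_values [OF binop [OF f]] by auto
    have "binop_B2 (f p p) (f p q) (f q p) (f q q) a x = f a x" for a x
    proof (cases "a \<in> B2 \<and> x \<in> B2")
      case True
      then show ?thesis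
        using vals(2-) by (auto simp: binop_B2_def B2_eq)
    next
      \<comment> \<open>Outside \<open>B2\<close> both sides take the same default value, by
        extensionality in the first or the second argument.\<close>
      case False
      then show ?thesis
        using f by (auto simp: binop_B2_def PiE_iff extensional_def)
    qed
    with vals(1) show ?thesis
      by auto
  qed
  have "binop_B2 u v s t \<in> ?F \<and> ?g (binop_B2 u v s t) = (u, v, s, t)"
    if "(u, v, s, t) \<in> ?V" for u v s t
  proof -
    let ?f = "binop_B2 u v s t"
    from that have V: "u \<in> B2" "v \<in> B2" "s \<in> B2" "t \<in> B2" "admissible_values u v s t"
      by auto
    then have maps: "additive_map e (map_B2 u v)" "additive_map e (map_B2 s t)"
      by (auto simp: additive_map_B2 admissible_values_def)
    then have "map_B2 u v x \<in> B2" "map_B2 s t x \<in> B2" if "x \<in> B2" for x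
      using that by (auto simp: additive_map_def)
    then have F: "?f \<in> B2 \<rightarrow>\<^sub>E (B2 \<rightarrow>\<^sub>E B2)"
      by (auto simp: binop_B2_def)
    have "S1 e ?f \<and> S2 e ?f \<and> S3 e ?f"
      unfolding axioms_iff_values [OF binop [OF F]]
      using V by (auto simp: binop_B2_def)
    with F show ?thesis
      by (simp add: binop_B2_def)
  qed
  then have h: "?h y \<in> ?F \<and> ?g (?h y) = y" if "y \<in> ?V" for y
    using that by (cases y) (simp only: prod.case)
  have "bij_betw ?g ?F ?V"
  proof (rule bij_betwI)
    show "?g \<in> ?F \<rightarrow> ?V"
      using g by (rule Pi_I [OF conjunct1])
    show "?h \<in> ?V \<rightarrow> ?F"
      using h by (rule Pi_I [OF conjunct1])
  qed (rule conjunct2 [OF g] conjunct2 [OF h], assumption)+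
  from bij_betw_same_card [OF this] show ?thesis
    by (simp only: card_admissible_values)
qed

theorem theorem6p1:
  shows
    "(\<forall>f. binop_on e f \<longrightarrow>
        (S1 e f \<and> S2 e f \<and> S3 e f \<longleftrightarrow>
          (\<exists>A B. admissible_maps A B \<and>
            (\<forall>x\<in>B2. f 0 x = 0 \<and> f p x = A x \<and> f q x = B x \<and> f e x = x))))
     \<and> (\<forall>u\<in>B2. \<forall>v\<in>B2. \<forall>s\<in>B2. \<forall>t\<in>B2.
          (\<exists>A B. admissible_maps A B \<and> A p = u \<and> A q = v \<and> B p = s \<and> B q = t)
            \<longleftrightarrow> admissible_values u v s t)
     \<and> (\<forall>f. binop_on e f \<longrightarrow>
        (S1 e f \<and> S2 e f \<and> S3 e f \<longleftrightarrow>
          (\<exists>u\<in>B2. \<exists>v\<in>B2. \<exists>s\<in>B2. \<exists>t\<in>B2. admissible_values u v s t \<and>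
            (\<forall>x\<in>B2. f 0 x = 0 \<and> f e x = x) \<and>
            f p 0 = 0 \<and> f p p = u \<and> f p q = v \<and> f p e = u + v \<and>
            f q 0 = 0 \<and> f q p = s \<and> f q q = t \<and> f q e = s + t)))
     \<and> card {f \<in> B2 \<rightarrow>\<^sub>E (B2 \<rightarrow>\<^sub>E B2). S1 e f \<and> S2 e f \<and> S3 e f} = 34"
  by (intro conjI allI impI ballI;
      (erule axioms_iff_maps axioms_iff_values | rule card_axioms
        | (rule admissible_maps_iff_values; assumption)))

end
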